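(* Let $n\ge 1$. The functional $\mathrm{Sdet}$ is the unique functional $\mathcal{D}:\mathbb{H}^{n\times n}\to\mathbb{R}_{+}$ which is multiplicative, i.e. $\mathcal{D}[MN]=\mathcal{D}[NM]=\mathcal{D}[M]\,\mathcal{D}[N]$ for all $M,N\in\mathbb{H}^{n\times n}$, and satisfies the scaling condition $\mathcal{D}[qI]=|q|^n$ for all $q\in\mathbb{H}$.
   Context: $\mathbb{H}$ is the skew-field of real quaternions $q=a+ib+jc+kd$ with $a,b,c,d\in\mathbb{R}$, $i^2=j^2=k^2=ijk=-1$, and norm $|q|=\sqrt{a^2+b^2+c^2+d^2}$. $\mathbb{R}_{+}$ denotes the nonnegative real numbers. $I$ is the $n\times n$ identity matrix. Every $M\in\mathbb{H}^{n\times n}$ is uniquely written $M=M_1+jM_2$ with $M_1,M_2\in\mathbb{C}^{n\times n}$ (where $\mathbb{C}=\mathbb{R}+i\mathbb{R}\subset\mathbb{H}$), and its complexification is the complex $2n\times 2n$ matrix $\mathcal{Z}[M]=\begin{pmatrix} M_1 & -M_2^*\\ M_2 & M_1^*\end{pmatrix}$, where $*$ is entrywise complex conjugation. The determinant $\det\mathcal{Z}[M]$ (the $q$-determinant) is real and nonnegative, and the Study determinant is normalized by $\mathrm{Sdet}[M]=\left(\det \mathcal{Z}[M]\right)^{1/2}\ge 0$. *)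

theory Defs
  imports "HOL-Analysis.Analysis"
begin

datatype quat = Quat (QRe: real) (QI: real) (QJ: real) (QK: real)

lemma quat_eq_iff: "p = q \<longleftrightarrow> QRe p = QRe q \<and> QI p = QI q \<and> QJ p = QJ q \<and> QK p = QK q"
  by (auto intro: quat.expand)

instantiation quat :: ab_group_add
begin

definition zero_quat :: quat where "0 = Quat 0 0 0 0"
definition plus_quat :: "quat \<Rightarrow> quat \<Rightarrow> quat" where
  "p + q = Quat (QRe p + QRe q) (QI p + QI q) (QJ p + QJ q) (QK p + QK q)"
definition uminus_quat :: "quat \<Rightarrow> quat" where
  "- q = Quat (- QRe q) (- QI q) (- QJ q) (- QK q)"
definition minus_quat :: "quat \<Rightarrow> quat \<Rightarrow> quat" where
  "p - q = Quat (QRe p - QRe q) (QI p - QI q) (QJ p - QJ q) (QK p - QK q)"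

instance
  by standard (simp_all add: zero_quat_def plus_quat_def uminus_quat_def minus_quat_def)

end

instantiation quat :: ring_1
begin

definition one_quat :: quat where "1 = Quat 1 0 0 0"
definition times_quat :: "quat \<Rightarrow> quat \<Rightarrow> quat" where
  "p * q = Quat
     (QRe p * QRe q - QI p * QI q - QJ p * QJ q - QK p * QK q)
     (QRe p * QI q + QI p * QRe q + QJ p * QK q - QK p * QJ q)
     (QRe p * QJ q - QI p * QK q + QJ p * QRe q + QK p * QI q)
     (QRe p * QK q + QI p * QJ q - QJ p * QI q + QK p * QRe q)"

instance
  by standard
    (simp_all add: zero_quat_def one_quat_def plus_quat_def times_quat_def algebra_simps)

end

lemma quat_sel_simps [simp]:
  "QRe 0 = 0" "QI 0 = 0" "QJ 0 = 0" "QK 0 = 0"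
  "QRe 1 = 1" "QI 1 = 0" "QJ 1 = 0" "QK 1 = 0"
  "QRe (p + q) = QRe p + QRe q" "QI (p + q) = QI p + QI q"
  "QJ (p + q) = QJ p + QJ q" "QK (p + q) = QK p + QK q"
  "QRe (p - q) = QRe p - QRe q" "QI (p - q) = QI p - QI q"
  "QJ (p - q) = QJ p - QJ q" "QK (p - q) = QK p - QK q"
  "QRe (- q) = - QRe q" "QI (- q) = - QI q" "QJ (- q) = - QJ q" "QK (- q) = - QK q"
  by (simp_all add: zero_quat_def one_quat_def plus_quat_def minus_quat_def uminus_quat_def)

lemma quat_times_sel:
  "QRe (p * q) = QRe p * QRe q - QI p * QI q - QJ p * QJ q - QK p * QK q"
  "QI (p * q) = QRe p * QI q + QI p * QRe q + QJ p * QK q - QK p * QJ q"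
  "QJ (p * q) = QRe p * QJ q - QI p * QK q + QJ p * QRe q + QK p * QI q"
  "QK (p * q) = QRe p * QK q + QI p * QJ q - QJ p * QI q + QK p * QRe q"
  by (simp_all add: times_quat_def)

instantiation quat :: real_algebra_1
begin

definition scaleR_quat :: "real \<Rightarrow> quat \<Rightarrow> quat" where
  "r *\<^sub>R q = Quat (r * QRe q) (r * QI q) (r * QJ q) (r * QK q)"

instance
  by standard (simp_all add: scaleR_quat_def quat_eq_iff quat_times_sel algebra_simps)

end

instantiation quat :: real_normed_div_algebra
begin

definition norm_quat :: "quat \<Rightarrow> real" where
  "norm q = sqrt ((QRe q)\<^sup>2 + (QI q)\<^sup>2 + (QJ q)\<^sup>2 + (QK q)\<^sup>2)"
definition inverse_quat :: "quat \<Rightarrow> quat" where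
  "inverse q = (1 / (norm q)\<^sup>2) *\<^sub>R Quat (QRe q) (- QI q) (- QJ q) (- QK q)"
definition divide_quat :: "quat \<Rightarrow> quat \<Rightarrow> quat" where "p div q = p * inverse (q :: quat)"
definition sgn_quat :: "quat \<Rightarrow> quat" where "sgn q = q /\<^sub>R norm (q :: quat)"
definition dist_quat :: "quat \<Rightarrow> quat \<Rightarrow> real" where "dist p q = norm (p - q :: quat)"
definition uniformity_quat :: "(quat \<times> quat) filter" where
  "uniformity = (INF e\<in>{0 <..}. principal {(x :: quat, y). dist x y < e})"
definition open_quat :: "quat set \<Rightarrow> bool" where
  "open U \<longleftrightarrow> (\<forall>x\<in>U. eventually (\<lambda>(x' :: quat, y). x' = x \<longrightarrow> y \<in> U) uniformity)"

instance
proof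
  have norm_sq: "(norm q)\<^sup>2 = (QRe q)\<^sup>2 + (QI q)\<^sup>2 + (QJ q)\<^sup>2 + (QK q)\<^sup>2" for q :: quat
    by (simp add: norm_quat_def)
  have norm_pair: "norm q = norm (Complex (QRe q) (QI q), Complex (QJ q) (QK q))" for q :: quat
    by (simp add: norm_quat_def norm_Pair norm_complex_def add.assoc)
  fix p q :: quat and r :: real
  show norm0: "norm q = 0 \<longleftrightarrow> q = 0" for q :: quat
    unfolding norm_pair by (simp add: quat_eq_iff zero_prod_def complex_eq_iff)
  show "norm (p + q) \<le> norm p + norm q"
    using norm_triangle_ineq[of "(Complex (QRe p) (QI p), Complex (QJ p) (QK p))"
        "(Complex (QRe q) (QI q), Complex (QJ q) (QK q))"]
    by (simp add: norm_pair complex_add)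
  show "norm (r *\<^sub>R q) = \<bar>r\<bar> * norm q"
  proof -
    have "norm (r *\<^sub>R q) = sqrt (r\<^sup>2 * ((QRe q)\<^sup>2 + (QI q)\<^sup>2 + (QJ q)\<^sup>2 + (QK q)\<^sup>2))"
      by (simp add: norm_quat_def scaleR_quat_def power_mult_distrib distrib_left)
    then show ?thesis
      by (simp add: norm_quat_def real_sqrt_mult)
  qed
  show "norm (p * q) = norm p * norm q"
    unfolding norm_quat_def real_sqrt_mult[symmetric]
    by (rule arg_cong[of _ _ sqrt])
      (simp add: quat_times_sel power2_eq_square algebra_simps)
  have nz: "(QRe q)\<^sup>2 + (QI q)\<^sup>2 + (QJ q)\<^sup>2 + (QK q)\<^sup>2 \<noteq> 0" if "q \<noteq> 0" for q :: quat
    using norm0[of q] that by (metis norm_sq zero_eq_power2)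
  show "inverse q * q = 1" if "q \<noteq> 0"
    using nz[OF that] unfolding inverse_quat_def norm_sq
    by (simp add: quat_eq_iff quat_times_sel scaleR_quat_def add_divide_distrib[symmetric]
        power2_eq_square algebra_simps)
  show "q * inverse q = 1" if "q \<noteq> 0"
    using nz[OF that] unfolding inverse_quat_def norm_sq
    by (simp add: quat_eq_iff quat_times_sel scaleR_quat_def add_divide_distrib[symmetric]
        power2_eq_square algebra_simps)
  show "inverse (0 :: quat) = 0"
    by (simp add: inverse_quat_def quat_eq_iff scaleR_quat_def)
qed (simp_all add: divide_quat_def sgn_quat_def dist_quat_def uniformity_quat_def open_quat_def)

end

definition quat_i :: quat where "quat_i = Quat 0 1 0 0"
definition quat_j :: quat where "quat_j = Quat 0 0 1 0"
definition quat_k :: quat where "quat_k = Quat 0 0 0 1"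

lemma quat_units:
  "quat_i * quat_i = -1" "quat_j * quat_j = -1" "quat_k * quat_k = -1"
  "quat_i * quat_j * quat_k = -1"
  by (simp_all add: quat_i_def quat_j_def quat_k_def quat_eq_iff quat_times_sel)

definition quat_of_complex :: "complex \<Rightarrow> quat" where
  "quat_of_complex z = Quat (Re z) (Im z) 0 0"

text \<open>The components \<open>M\<^sub>1, M\<^sub>2\<close> of \<open>M = M\<^sub>1 + j M\<^sub>2\<close>. Since \<open>j i = - k\<close>, the coefficient
  of \<open>k\<close> enters \<open>M\<^sub>2\<close> with a minus sign; lemma \<open>quat_part_unique\<close> confirms the convention.\<close>

definition quat_part1 :: "quat \<Rightarrow> complex" where "quat_part1 q = Complex (QRe q) (QI q)"
definition quat_part2 :: "quat \<Rightarrow> complex" where "quat_part2 q = Complex (QJ q) (- QK q)"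

lemma quat_part_unique:
  "q = quat_of_complex z + quat_j * quat_of_complex w \<longleftrightarrow> z = quat_part1 q \<and> w = quat_part2 q"
  by (auto simp: quat_part1_def quat_part2_def quat_of_complex_def quat_j_def quat_eq_iff
      quat_times_sel complex_eq_iff)

text \<open>The \<open>2 \<times> 2\<close> block matrix is indexed by the sum type: \<open>Inl\<close> is the first block row
  (column), \<open>Inr\<close> the second.\<close>

definition complexify :: "quat^'n^'n \<Rightarrow> complex^('n + 'n)^('n + 'n)" where
  "complexify M = (\<chi> r s. case (r, s) of
       (Inl i, Inl j) \<Rightarrow> quat_part1 (M $ i $ j)
     | (Inl i, Inr j) \<Rightarrow> - cnj (quat_part2 (M $ i $ j))
     | (Inr i, Inl j) \<Rightarrow> quat_part2 (M $ i $ j)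
     | (Inr i, Inr j) \<Rightarrow> cnj (quat_part1 (M $ i $ j)))"

lemma det_complexify_real: "det (complexify (M :: quat^'n^'n)) \<in> \<real>"
proof -
  let ?Z = "complexify M"
  let ?C = "(\<chi> r s. cnj (?Z $ r $ s)) :: complex^('n + 'n)^('n + 'n)"
  define J :: "complex^('n + 'n)^('n + 'n)" where
    "J = (\<chi> r s. case (r, s) of
       (Inl i, Inr j) \<Rightarrow> if i = j then -1 else 0
     | (Inr i, Inl j) \<Rightarrow> if i = j then 1 else 0
     | _ \<Rightarrow> 0)"
  have sum_split: "(\<Sum>k\<in>UNIV. f k) = (\<Sum>i\<in>UNIV. f (Inl i)) + (\<Sum>i\<in>UNIV. f (Inr i))"
    for f :: "'n + 'n \<Rightarrow> complex"
    by (simp add: UNIV_Plus_UNIV[symmetric] sum.Plus del: UNIV_Plus_UNIV)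
  have JJ: "(J ** J) $ r $ s = (mat (-1)) $ r $ s" for r s
    by (cases r; cases s)
      (simp_all add: J_def matrix_matrix_mult_def sum_split mat_def if_distrib if_distribR
        cong: if_cong)
  have "J ** J = mat (-1)"
    using JJ by (simp add: vec_eq_iff)
  moreover have "det (mat (-1) :: complex^('n + 'n)^('n + 'n)) \<noteq> 0"
    by (subst det_diagonal) (auto simp: mat_def)
  ultimately have nz: "det J \<noteq> 0"
    by (metis det_mul mult_zero_left)
  have "(J ** ?Z) $ r $ s = (?C ** J) $ r $ s" for r s
    by (cases r; cases s)
      (simp_all add: J_def complexify_def matrix_matrix_mult_def sum_split if_distrib if_distribR
        cong: if_cong)
  then have "J ** ?Z = ?C ** J"
    by (simp add: vec_eq_iff)
  then have "det J * det ?Z = det ?C * det J"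
    by (metis det_mul)
  then have "det ?C = det ?Z"
    using nz by simp
  moreover have "det ?C = cnj (det ?Z)"
    by (simp add: det_def)
  ultimately show ?thesis
    by (metis Reals_cnj_iff)
qed

text \<open>\<open>Re\<close> only changes the type here, by lemma \<open>det_complexify_real\<close>. As \<open>sqrt\<close> is negative
  on negative arguments, no absolute value is hidden in this definition.\<close>

definition Sdet :: "quat^'n^'n \<Rightarrow> real" where
  "Sdet M = sqrt (Re (det (complexify M)))"

text \<open>\<open>mat q\<close> is the matrix \<open>q I\<close>; the entries of \<open>quat^'n^'n\<close> do not commute, and \<open>**\<close> keeps
  the left factor's entries on the left.\<close>

definition multiplicative :: "(quat^'n^'n \<Rightarrow> real) \<Rightarrow> bool" where
  "multiplicative D \<longleftrightarrow>
     (\<forall>M N. D (M ** N) = D M * D N \<and> D (N ** M) = D M * D N)"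

definition scaling_condition :: "(quat^'n^'n \<Rightarrow> real) \<Rightarrow> bool" where
  "scaling_condition D \<longleftrightarrow> (\<forall>q. D (mat q) = norm q ^ CARD('n))"

definition study_functional :: "(quat^'n^'n \<Rightarrow> real) \<Rightarrow> bool" where
  "study_functional D \<longleftrightarrow> (\<forall>M. 0 \<le> D M) \<and> multiplicative D \<and> scaling_condition D"

end

theory Submission
  imports Defs
begin

text \<open>Over a division ring, Gaussian elimination writes every square matrix as a product of
  diagonal matrices and shears (the identity plus a column or a row without diagonal entry); no
  permutation matrices are needed. A shear is conjugate to its inverse, so a study functional is
  \<open>1\<close> on it. The diagonal matrices with the single nontrivial entry \<open>q\<close> are conjugate to each other
  and their product over all positions is \<open>q I\<close>, so the functional takes the value \<open>|q|\<close> on each.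
  This gives uniqueness. As to existence, shears and diagonal quaternion matrices are squares, so
  \<open>det Z[M]\<close> is a product of squares of real numbers. The scaling condition follows from
  \<open>Z[q I] Z[q I]\<^sup>H = |q|\<^sup>2 I\<close>.\<close>

section \<open>Elementary matrices over a noncommutative ring\<close>

definition diag_mat :: "('n \<Rightarrow> 'a::zero) \<Rightarrow> 'a^'n^'n" where
  "diag_mat q = (\<chi> i j. if i = j then q i else 0)"

text \<open>The diagonal is \<open>1\<close> whatever \<open>v k\<close> is, so shears with the same
  \<open>k\<close> multiply by adding their \<open>v\<close> without a side condition.\<close>

definition col_shear :: "'n \<Rightarrow> ('n \<Rightarrow> 'a::ring_1) \<Rightarrow> 'a^'n^'n" where
  "col_shear k v = (\<chi> i j. if i = j then 1 else if j = k then v i else 0)"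

definition row_shear :: "'n \<Rightarrow> ('n \<Rightarrow> 'a::ring_1) \<Rightarrow> 'a^'n^'n" where
  "row_shear k v = (\<chi> i j. if i = j then 1 else if i = k then v j else 0)"

definition swap_mat :: "'n \<Rightarrow> 'n \<Rightarrow> 'a::ring_1^'n^'n" where
  "swap_mat a b = (\<chi> i j. if j = Transposition.transpose a b i then 1 else 0)"

lemma diag_mat_mult_nth:
  fixes A :: "'a::ring_1^'n^'n"
  shows "(diag_mat q ** A) $ i $ j = q i * A $ i $ j"
  by (simp add: diag_mat_def matrix_matrix_mult_def if_distrib if_distribR cong: if_cong)

lemma mult_diag_mat_nth:
  fixes A :: "'a::ring_1^'n^'n"
  shows "(A ** diag_mat q) $ i $ j = A $ i $ j * q j"
  by (simp add: diag_mat_def matrix_matrix_mult_def if_distrib if_distribR cong: if_cong)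

lemma col_shear_mult_nth:
  fixes A :: "'a::ring_1^'n^'n"
  shows "(col_shear k v ** A) $ i $ j = A $ i $ j + (if i = k then 0 else v i * A $ k $ j)"
proof -
  have "(col_shear k v ** A) $ i $ j =
      (\<Sum>l\<in>UNIV. (if l = i then A $ l $ j else 0) + (if l = k then if i = k then 0 else v i * A $ l $ j else 0))"
    unfolding matrix_matrix_mult_def by (auto simp: col_shear_def intro!: sum.cong)
  then show ?thesis by (simp add: sum.distrib)
qed

lemma mult_row_shear_nth:
  fixes A :: "'a::ring_1^'n^'n"
  shows "(A ** row_shear k v) $ i $ j = A $ i $ j + (if j = k then 0 else A $ i $ k * v j)"
proof -
  have "(A ** row_shear k v) $ i $ j =
      (\<Sum>l\<in>UNIV. (if l = j then A $ i $ l else 0) + (if l = k then if j = k then 0 else A $ i $ l * v j else 0))"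
    unfolding matrix_matrix_mult_def by (auto simp: row_shear_def intro!: sum.cong)
  then show ?thesis by (simp add: sum.distrib)
qed

lemma swap_mat_mult_nth:
  fixes A :: "'a::ring_1^'n^'n"
  shows "(swap_mat a b ** A) $ i $ j = A $ Transposition.transpose a b i $ j"
  by (simp add: swap_mat_def matrix_matrix_mult_def if_distrib if_distribR cong: if_cong)

lemma mult_swap_mat_nth:
  fixes A :: "'a::ring_1^'n^'n"
  shows "(A ** swap_mat a b) $ i $ j = A $ i $ Transposition.transpose a b j"
proof -
  have "j = Transposition.transpose a b l \<longleftrightarrow> l = Transposition.transpose a b j" for l
    by (metis transpose_involutory)
  then show ?thesis
    by (simp add: swap_mat_def matrix_matrix_mult_def if_distrib if_distribR cong: if_cong)
qed

lemma diag_mat_mult: "diag_mat p ** diag_mat q = diag_mat (\<lambda>i. p i * (q i :: 'a::ring_1))"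
  by (simp add: vec_eq_iff diag_mat_mult_nth) (simp add: diag_mat_def)

lemma diag_mat_const: "diag_mat (\<lambda>i. q) = mat q"
  by (simp add: diag_mat_def mat_def)

lemma col_shear_mult: "col_shear k v ** col_shear k w = col_shear k (\<lambda>i. v i + w i)"
  by (simp add: vec_eq_iff col_shear_mult_nth) (auto simp: col_shear_def)

lemma row_shear_mult: "row_shear k v ** row_shear k w = row_shear k (\<lambda>i. v i + w i)"
  by (simp add: vec_eq_iff mult_row_shear_nth) (auto simp: row_shear_def)

lemma col_shear_0: "col_shear k (\<lambda>i. 0) = mat 1"
  by (simp add: vec_eq_iff col_shear_def mat_def)

lemma row_shear_0: "row_shear k (\<lambda>i. 0) = mat 1"
  by (simp add: vec_eq_iff row_shear_def mat_def)

lemma swap_mat_mult_self: "swap_mat a b ** swap_mat a b = mat 1"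
  by (simp add: vec_eq_iff swap_mat_mult_nth) (auto simp: swap_mat_def mat_def)

text \<open>Each nonzero off-diagonal entry has exactly one index equal to \<open>k\<close> and so
  meets one sign; a diagonal entry meets both signs or none.\<close>

lemma col_shear_conj:
  "diag_mat (\<lambda>i. if i = k then -1 else 1) ** col_shear k v ** diag_mat (\<lambda>i. if i = k then -1 else 1)
    = col_shear k (\<lambda>i. - v i)"
  by (simp add: vec_eq_iff diag_mat_mult_nth mult_diag_mat_nth) (auto simp: col_shear_def)

lemma row_shear_conj:
  "diag_mat (\<lambda>i. if i = k then -1 else 1) ** row_shear k v ** diag_mat (\<lambda>i. if i = k then -1 else 1)
    = row_shear k (\<lambda>i. - v i)"
  by (simp add: vec_eq_iff diag_mat_mult_nth mult_diag_mat_nth) (auto simp: row_shear_def)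

lemma diag_mat_swap_conj:
  "swap_mat a b ** diag_mat q ** swap_mat a b = diag_mat (\<lambda>i. q (Transposition.transpose a b i))"
  by (simp add: vec_eq_iff swap_mat_mult_nth mult_swap_mat_nth)
    (auto simp: diag_mat_def dest: transpose_eq_imp_eq)

section \<open>Gaussian elimination over a division ring\<close>

text \<open>Elimination stated as an induction rule; it serves both uniqueness and nonnegativity of
  the determinant.\<close>

lemma matrix_induct_shear [case_names mult diag col row]:
  fixes P :: "'a::division_ring^'n^'n \<Rightarrow> bool"
  assumes mult: "\<And>A B. P A \<Longrightarrow> P B \<Longrightarrow> P (A ** B)"
    and diag: "\<And>q. P (diag_mat q)"
    and col: "\<And>k v. P (col_shear k v)"
    and row: "\<And>k v. P (row_shear k v)"
  shows "P A"
proof -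
  \<comment> \<open>A shear can be undone by the shear with \<open>- v\<close>, so \<open>P\<close>
    may be proved after any row or column operation.\<close>
  have P_col: "P A" if "P (col_shear k v ** A)" for k v A
  proof -
    have "col_shear k (\<lambda>i. - v i) ** (col_shear k v ** A) = A"
      by (simp add: matrix_mul_assoc col_shear_mult col_shear_0)
    then show ?thesis using mult[OF col that] by metis
  qed
  have P_row: "P A" if "P (A ** row_shear k v)" for k v A
  proof -
    have "(A ** row_shear k v) ** row_shear k (\<lambda>i. - v i) = A"
      by (simp add: matrix_mul_assoc[symmetric] row_shear_mult row_shear_0)
    then show ?thesis using mult[OF that row] by metis
  qed
  \<comment> \<open>\<open>S\<close> collects the indices already split off; the induction is on the
    number of remaining ones.\<close>
  define clean where "clean S A \<longleftrightarrow> (\<forall>i\<in>S. \<forall>j. j \<noteq> i \<longrightarrow> A $ i $ j = 0 \<and> A $ j $ i = 0)"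
    for S and A :: "'a^'n^'n"
  have "P A" if "clean S A" for S A
    using that
  proof (induction "card (- S)" arbitrary: S A rule: less_induct)
    case less
    have pivot: "P B" if B: "clean S B" "B $ k $ k \<noteq> 0" "k \<notin> S" for B k
    proof -
      let ?u = "inverse (B $ k $ k)"
      \<comment> \<open>Row operations multiply on the left and column operations on the right,
        which fixes the side of \<open>?u\<close>. Both coefficients vanish at indices in
        \<open>S\<close>, so these stay clean.\<close>
      let ?v = "\<lambda>i. - (B $ i $ k * ?u)" and ?w = "\<lambda>j. - (?u * B $ k $ j)"
      let ?C = "col_shear k ?v ** B ** row_shear k ?w"
      have "clean (insert k S) ?C"
        using B unfolding clean_def
        by (auto simp: mult_row_shear_nth col_shear_mult_nth mult.assoc mult.assoc[symmetric, of _ ?u])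
      moreover have "card (- insert k S) < card (- S)"
        using B(3) by (intro psubset_card_mono) auto
      ultimately have "P ?C" using less.hyps by blast
      then show ?thesis by (rule P_col[OF P_row])
    qed
    show ?case
    proof (cases "\<exists>p q. p \<noteq> q \<and> A $ p $ q \<noteq> 0")
      case False
      then have "A = diag_mat (\<lambda>i. A $ i $ i)"
        by (auto simp: vec_eq_iff diag_mat_def)
      then show ?thesis using diag by metis
    next
      case True
      then obtain p q where pq: "p \<noteq> q" "A $ p $ q \<noteq> 0" by blast
      \<comment> \<open>A nonzero off-diagonal entry cannot lie in a clean row or column.\<close>
      then have S: "p \<notin> S" "q \<notin> S" using less.prems by (auto simp: clean_def)
      show ?thesis
      proof (cases "A $ q $ q = 0")
        case False
        then show ?thesis using pivot less.prems S by blast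
      next
        case True
        \<comment> \<open>Adding row \<open>p\<close> to row \<open>q\<close> puts the nonzero
          \<open>A $ p $ q\<close> at the diagonal position \<open>q\<close>, which replaces a row
          exchange.\<close>
        let ?B = "col_shear p (\<lambda>i. if i = q then 1 else 0) ** A"
        have "clean S ?B"
          using less.prems S by (auto simp: clean_def col_shear_mult_nth)
        moreover have "?B $ q $ q \<noteq> 0"
          using pq True by (simp add: col_shear_mult_nth)
        ultimately have "P ?B" using pivot S by blast
        then show ?thesis by (rule P_col)
      qed
    qed
  qed
  \<comment> \<open>Every matrix is clean for the empty set.\<close>
  then show ?thesis by (force simp: clean_def)
qed

section \<open>Values forced on a study functional, and uniqueness\<close>

lemma study_functional_nonneg: "study_functional D \<Longrightarrow> 0 \<le> D M"
  and study_functional_mult: "study_functional D \<Longrightarrow> D (M ** N) = D M * D N"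
  and study_functional_mat: "study_functional D \<Longrightarrow> D (mat q :: quat^'n^'n) = norm q ^ CARD('n)"
  by (auto simp: study_functional_def multiplicative_def scaling_condition_def)

text \<open>Real values commute, so the two factors \<open>D J\<close> combine to
  \<open>D (mat 1) = 1\<close>.\<close>

lemma study_functional_conj_involution:
  assumes D: "study_functional D" and J: "J ** J = mat 1"
  shows "D (J ** M ** J) = D M"
proof -
  have "D J * D J = 1"
    using study_functional_mult[OF D, of J J] study_functional_mat[OF D, of 1] J by simp
  moreover have "D (J ** M ** J) = D J * D J * D M"
    by (simp only: study_functional_mult[OF D] mult_ac)
  ultimately show ?thesis by simp
qed

lemma diag_sign_mult_self:
  "diag_mat (\<lambda>i. if i = k then -1 else 1) ** diag_mat (\<lambda>i. if i = k then -1 else 1)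
    = (mat 1 :: 'a::ring_1^'n^'n)"
  by (simp add: diag_mat_mult diag_mat_const[symmetric] if_distrib cong: if_cong)

text \<open>\<open>A\<close> and its conjugate have equal values with product \<open>1\<close>;
  nonnegativity excludes \<open>-1\<close>.\<close>

lemma study_functional_conj_inverse:
  assumes D: "study_functional D" and J: "J ** J = mat 1" and A: "A ** (J ** A ** J) = mat 1"
  shows "D A = 1"
proof -
  have "D A * D A = 1"
    using study_functional_mult[OF D, of A "J ** A ** J"] study_functional_mat[OF D, of 1] A
    by (simp add: study_functional_conj_involution[OF D J])
  then show ?thesis
    using study_functional_nonneg[OF D, of A] by (simp add: square_eq_1_iff)
qed

lemma study_functional_col_shear:
  assumes "study_functional D"
  shows "D (col_shear k v) = 1"
  using assms diag_sign_mult_self[of k]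
  by (rule study_functional_conj_inverse) (simp add: col_shear_conj col_shear_mult col_shear_0)

lemma study_functional_row_shear:
  assumes "study_functional D"
  shows "D (row_shear k v) = 1"
  using assms diag_sign_mult_self[of k]
  by (rule study_functional_conj_inverse) (simp add: row_shear_conj row_shear_mult row_shear_0)

lemma study_functional_diag_mat:
  fixes D :: "quat^'n^'n \<Rightarrow> real"
  assumes D: "study_functional D"
  shows "D (diag_mat q) = (\<Prod>i\<in>UNIV. norm (q i))"
proof -
  define e where "e a x = D (diag_mat (\<lambda>i. if i = a then x else 1))" for a x
  have prod: "D (diag_mat (\<lambda>i. if i \<in> S then q i else 1)) = (\<Prod>i\<in>S. e i (q i))" for S q
  proof (induction S rule: finite_induct[OF finite])
    case 1
    then show ?case using study_functional_mat[OF D, of 1] by (simp add: diag_mat_const)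
  next
    case (2 a S)
    have "diag_mat (\<lambda>i. if i \<in> insert a S then q i else 1) =
        diag_mat (\<lambda>i. if i = a then q a else 1) ** diag_mat (\<lambda>i. if i \<in> S then q i else 1)"
      using 2 by (auto simp: diag_mat_mult intro!: arg_cong[of _ _ diag_mat])
    then show ?case using 2 by (simp add: study_functional_mult[OF D] e_def)
  qed
  \<comment> \<open>Conjugation by a swap moves the nontrivial entry from \<open>a\<close> to
    \<open>b\<close>.\<close>
  have e_eq: "e a x = e b x" for a b x
  proof -
    have "diag_mat (\<lambda>i. if i = b then x else 1) =
        swap_mat a b ** diag_mat (\<lambda>i. if i = a then x else 1) ** swap_mat a b"
      by (auto simp: diag_mat_swap_conj Transposition.transpose_def intro!: arg_cong[of _ _ diag_mat])
    then show ?thesis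
      unfolding e_def by (metis study_functional_conj_involution[OF D swap_mat_mult_self])
  qed
  have "e a x = norm x" for a x
  proof -
    \<comment> \<open>The left side is \<open>D (mat x)\<close>, known from the scaling condition;
      \<open>e a x\<close> is then its unique nonnegative root.\<close>
    have "(\<Prod>i\<in>(UNIV::'n set). e i x) = (\<Prod>i\<in>(UNIV::'n set). e a x)"
      using e_eq by (intro prod.cong) auto
    then have "e a x ^ CARD('n) = norm x ^ CARD('n)"
      using prod[of UNIV "\<lambda>_. x"] study_functional_mat[OF D, of x] by (simp add: diag_mat_const)
    then show ?thesis
      using power_eq_iff_eq_base[of "CARD('n)" "e a x" "norm x"]
      by (simp add: e_def study_functional_nonneg[OF D])
  qed
  then show ?thesis using prod[of UNIV q] by simp
qed

lemma study_functional_unique: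
  assumes "study_functional D" "study_functional E"
  shows "D = E"
proof
  fix A
  show "D A = E A"
    by (induction A rule: matrix_induct_shear)
      (simp_all add: assms study_functional_mult study_functional_diag_mat
        study_functional_col_shear study_functional_row_shear)
qed

section \<open>Multiplicativity of the complexification\<close>

lemma sum_UNIV_Plus:
  fixes f :: "'a::finite + 'b::finite \<Rightarrow> 'c::comm_monoid_add"
  shows "(\<Sum>k\<in>UNIV. f k) = (\<Sum>i\<in>UNIV. f (Inl i)) + (\<Sum>i\<in>UNIV. f (Inr i))"
  by (simp add: UNIV_Plus_UNIV[symmetric] sum.Plus del: UNIV_Plus_UNIV)

text \<open>Conjugates arise because \<open>z j = j (cnj z)\<close> for complex \<open>z\<close>,
  when \<open>j\<close> is moved to the left.\<close>

lemma quat_part1_mult: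
  "quat_part1 (p * q) = quat_part1 p * quat_part1 q - cnj (quat_part2 p) * quat_part2 q"
  by (simp add: quat_part1_def quat_part2_def complex_eq_iff quat_times_sel algebra_simps)

lemma quat_part2_mult:
  "quat_part2 (p * q) = quat_part2 p * quat_part1 q + cnj (quat_part1 p) * quat_part2 q"
  by (simp add: quat_part1_def quat_part2_def complex_eq_iff quat_times_sel algebra_simps)

lemma quat_part1_sum: "quat_part1 (sum f S) = (\<Sum>i\<in>S. quat_part1 (f i))"
  by (induction S rule: infinite_finite_induct)
    (simp_all add: quat_part1_def complex_eq_iff)

lemma quat_part2_sum: "quat_part2 (sum f S) = (\<Sum>i\<in>S. quat_part2 (f i))"
  by (induction S rule: infinite_finite_induct)
    (simp_all add: quat_part2_def complex_eq_iff)

lemma complexify_mult: "complexify (M ** N) = complexify M ** complexify N"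
proof -
  have "complexify (M ** N) $ r $ s = (complexify M ** complexify N) $ r $ s" for r s
    by (cases r; cases s)
      (simp_all add: complexify_def matrix_matrix_mult_def sum_UNIV_Plus quat_part1_sum
        quat_part2_sum quat_part1_mult quat_part2_mult sum.distrib sum_subtractf sum_negf
        algebra_simps)
  then show ?thesis by (simp add: vec_eq_iff)
qed

lemma Re_det_complexify_mult:
  "Re (det (complexify (M ** N))) = Re (det (complexify M)) * Re (det (complexify N))"
  using det_complexify_real[of M]
  by (simp add: complexify_mult det_mul complex_is_Real_iff)

section \<open>Square roots, and nonnegativity of the q-determinant\<close>

lemma quat_sqrt_exists:
  fixes q :: quat
  obtains p where "p * p = q"
proof (cases "norm q + QRe q = 0")
  case True
  \<comment> \<open>Here \<open>q\<close> is a nonpositive real, and a real multiple of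
    \<open>i\<close> is a root.\<close>
  then have r: "QRe q = - norm q" by simp
  have "(norm q)\<^sup>2 = (QRe q)\<^sup>2 + (QI q)\<^sup>2 + (QJ q)\<^sup>2 + (QK q)\<^sup>2"
    by (simp add: norm_quat_def)
  then have "(QI q)\<^sup>2 + (QJ q)\<^sup>2 + (QK q)\<^sup>2 = 0" by (simp add: r)
  then have "QI q = 0" "QJ q = 0" "QK q = 0"
    by (smt (verit) power2_less_eq_zero_iff zero_le_power2)+
  then have "Quat 0 (sqrt (norm q)) 0 0 * Quat 0 (sqrt (norm q)) 0 0 = q"
    by (simp add: quat_eq_iff quat_times_sel r)
  then show ?thesis by (rule that)
next
  case False
  have n: "(norm q)\<^sup>2 = (QRe q)\<^sup>2 + (QI q)\<^sup>2 + (QJ q)\<^sup>2 + (QK q)\<^sup>2"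
    by (simp add: norm_quat_def)
  then have "\<bar>QRe q\<bar> \<le> norm q"
    by (intro abs_le_square_iff[THEN iffD2, of _ "norm q", simplified]) auto
  with False have pos: "norm q + QRe q > 0" by linarith
  \<comment> \<open>The square root lies in the plane spanned by \<open>1\<close> and \<open>q\<close>, on the bisector of the two.\<close>
  define t where "t = 1 / sqrt (2 * (norm q + QRe q))"
  have t: "t * t * (2 * (norm q + QRe q)) = 1"
    using pos by (simp add: t_def)
  define s where "s = t * (norm q + QRe q)"
  have comp: "s * (t * x) + t * x * s = x" for x
    using t unfolding s_def by algebra
  have re: "s * s - t * QI q * (t * QI q) - t * QJ q * (t * QJ q) - t * QK q * (t * QK q) = QRe q"
    using n t unfolding s_def by algebra
  let ?p = "Quat s (t * QI q) (t * QJ q) (t * QK q)"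
  have "QRe (?p * ?p) = QRe q" "QI (?p * ?p) = QI q" "QJ (?p * ?p) = QJ q" "QK (?p * ?p) = QK q"
    using re comp[of "QI q"] comp[of "QJ q"] comp[of "QK q"]
    by (simp_all add: quat_times_sel mult_ac)
  then have "?p * ?p = q"
    by (simp only: quat_eq_iff)
  then show ?thesis by (rule that)
qed

lemma Re_det_complexify_nonneg: "0 \<le> Re (det (complexify A))"
proof (induction A rule: matrix_induct_shear)
  case (mult A B)
  then show ?case by (simp add: Re_det_complexify_mult)
next
  case (diag q)
  \<comment> \<open>A square matrix root makes the real determinant the square of a real number; for
    the shears below the root is obtained by halving \<open>v\<close>.\<close>
  have "\<forall>i. \<exists>x. x * x = q i" by (meson quat_sqrt_exists)
  then obtain p where p: "\<And>i. p i * p i = q i" by metis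
  have "diag_mat q = diag_mat p ** diag_mat p" by (simp add: diag_mat_mult p)
  then show ?case by (simp add: Re_det_complexify_mult)
next
  case (col k v)
  have "col_shear k v = col_shear k (\<lambda>i. (1/2) *\<^sub>R v i) ** col_shear k (\<lambda>i. (1/2) *\<^sub>R v i)"
    by (simp add: col_shear_mult scaleR_left_distrib[symmetric])
  then show ?case by (simp add: Re_det_complexify_mult)
next
  case (row k v)
  have "row_shear k v = row_shear k (\<lambda>i. (1/2) *\<^sub>R v i) ** row_shear k (\<lambda>i. (1/2) *\<^sub>R v i)"
    by (simp add: row_shear_mult scaleR_left_distrib[symmetric])
  then show ?case by (simp add: Re_det_complexify_mult)
qed

section \<open>The scaling condition for the Study determinant\<close>

definition quat_cnj :: "quat \<Rightarrow> quat" where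
  "quat_cnj q = Quat (QRe q) (- QI q) (- QJ q) (- QK q)"

lemma mult_quat_cnj: "q * quat_cnj q = of_real ((norm q)\<^sup>2)"
  by (simp add: of_real_def scaleR_quat_def quat_eq_iff quat_times_sel quat_cnj_def norm_quat_def
      power2_eq_square)

lemma mat_mult_mat: "mat a ** mat b = (mat (a * b) :: 'a::ring_1^'n^'n)"
  by (simp add: diag_mat_const[symmetric] diag_mat_mult)

text \<open>Quaternion conjugation of the scalar becomes the conjugate transpose of
  \<open>?Z\<close>, and the determinant of \<open>?Z\<close> is real.\<close>

lemma det_complexify_mat_cnj:
  "det (complexify (mat (quat_cnj q) :: quat^'n^'n)) = det (complexify (mat q :: quat^'n^'n))"
proof -
  let ?Z = "complexify (mat q :: quat^'n^'n)"
  have "complexify (mat (quat_cnj q) :: quat^'n^'n) $ r $ s = cnj (transpose ?Z $ r $ s)" for r s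
    by (cases r; cases s)
      (auto simp: complexify_def mat_def quat_cnj_def transpose_def quat_part1_def quat_part2_def
        complex_eq_iff)
  then have "det (complexify (mat (quat_cnj q) :: quat^'n^'n)) = cnj (det (transpose ?Z))"
    by (simp add: det_def)
  then show ?thesis
    using det_complexify_real[of "mat q :: quat^'n^'n"] by (simp add: det_transpose Reals_cnj_iff)
qed

lemma det_complexify_of_real:
  "det (complexify (mat (of_real x) :: quat^'n^'n)) = of_real x ^ (2 * CARD('n))"
proof -
  have "complexify (mat (of_real x) :: quat^'n^'n) $ r $ s = (mat (of_real x)) $ r $ s" for r s
    by (cases r; cases s)
      (auto simp: complexify_def mat_def quat_part1_def quat_part2_def complex_eq_iff
        of_real_def[where 'a=quat] scaleR_quat_def)
  then have "complexify (mat (of_real x) :: quat^'n^'n) = mat (of_real x)"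
    by (simp add: vec_eq_iff)
  moreover have "det (mat (of_real x) :: complex^('n+'n)^('n+'n)) = of_real x ^ (2 * CARD('n))"
    by (subst det_diagonal) (auto simp: mat_def mult_2)
  ultimately show ?thesis by simp
qed

lemma Sdet_mat: "Sdet (mat q :: quat^'n^'n) = norm q ^ CARD('n)"
proof -
  let ?d = "Re (det (complexify (mat q :: quat^'n^'n)))"
  \<comment> \<open>The second factor comes from \<open>mat (quat_cnj q)\<close>, which has the same
    determinant; the exponent is the size of the complex matrix.\<close>
  have "?d * ?d = ((norm q)\<^sup>2) ^ (2 * CARD('n))"
    using Re_det_complexify_mult[of "mat q :: quat^'n^'n" "mat (quat_cnj q)"]
    by (simp add: mat_mult_mat mult_quat_cnj det_complexify_of_real det_complexify_mat_cnj
        del: of_real_power flip: of_real_power)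
  moreover have "((norm q)\<^sup>2) ^ (2 * CARD('n)) = ((norm q ^ CARD('n))\<^sup>2)\<^sup>2"
    by (simp add: power_mult[symmetric] mult_ac)
  ultimately have "?d\<^sup>2 = ((norm q ^ CARD('n))\<^sup>2)\<^sup>2"
    by (simp add: power2_eq_square)
  \<comment> \<open>Nonnegativity of \<open>?d\<close> selects the sign of the root.\<close>
  then have "?d = (norm q ^ CARD('n))\<^sup>2"
    by (rule power2_eq_imp_eq) (simp_all add: Re_det_complexify_nonneg)
  then show ?thesis by (simp add: Sdet_def)
qed

lemma study_functional_Sdet: "study_functional Sdet"
  by (simp add: study_functional_def multiplicative_def scaling_condition_def Sdet_mat)
    (simp add: Sdet_def Re_det_complexify_mult Re_det_complexify_nonneg real_sqrt_mult)

theorem theorem5p1: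
  shows "study_functional (Sdet :: quat^'n^'n \<Rightarrow> real) \<and>
    (\<forall>D :: quat^'n^'n \<Rightarrow> real. study_functional D \<longrightarrow> D = Sdet)"
  using study_functional_Sdet study_functional_unique by blast

end
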